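(* Let $n_1,n_2,n_3\ge 1$ be integers satisfying both of the following conditions. $C_1$: $\min\left\{\frac{(n_1+1)(n_1+2)}{2},\frac{(n_2+2)(n_2+3)}{2},\frac{(n_3+1)(n_3+2)}{2}\right\}>n_1+n_2+n_3+2$. $C_2$: there do not exist disjoint subsets $S_1,S_3\subseteq\{1,2,\ldots,n_1+n_2+n_3+2\}$ with $|S_1|=n_1+1$, $|S_3|=n_3+1$ such that the sum of the elements of $S_1$ equals the sum of the elements of $S_3$. Then $\chi_{la}(Ct(3;n_1,n_2,n_3))=n_1+n_2+n_3+3$.
   Context: A local antimagic labeling of a connected graph $G=(V,E)$ is a bijection $f:E\to\{1,\dots,|E|\}$ such that, with $f^+(u)=\sum f(e)$ (sum over all edges $e$ incident to $u$), one has $f^+(u)\neq f^+(v)$ for every pair of adjacent vertices $u,v$. The color number $c(f)$ is the number of distinct values of $f^+$ on $V$. The local antimagic chromatic number $\chi_{la}(G)$ is the minimum of $c(f)$ over all local antimagic labelings $f$ of $G$. $Ct(3;n_1,n_2,n_3)$ is the caterpillar obtained from the path $v_1v_2v_3$ on three vertices by joining $n_i$ new pendant (degree-one) vertices to $v_i$ for $i=1,2,3$. *)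

theory Defs
  imports Main "HOL-Library.Extended_Nat"
begin

text \<open>A graph is a pair of a vertex set and an edge set; an edge is an unordered pair of vertices.\<close>

type_synonym 'a ugraph = "'a set \<times> 'a set set"

abbreviation verts :: "'a ugraph \<Rightarrow> 'a set" where "verts G \<equiv> fst G"
abbreviation edges :: "'a ugraph \<Rightarrow> 'a set set" where "edges G \<equiv> snd G"

definition simple_graph :: "'a ugraph \<Rightarrow> bool" where
  "simple_graph G \<longleftrightarrow>
     finite (verts G) \<and> (\<forall>e \<in> edges G. e \<subseteq> verts G \<and> card e = 2)"

definition adj_rel :: "'a ugraph \<Rightarrow> ('a \<times> 'a) set" where
  "adj_rel G = {(u, v). {u, v} \<in> edges G}"

definition connected_graph :: "'a ugraph \<Rightarrow> bool" where
  "connected_graph G \<longleftrightarrow>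
     simple_graph G \<and> verts G \<noteq> {} \<and>
     (\<forall>u \<in> verts G. \<forall>v \<in> verts G. (u, v) \<in> (adj_rel G)\<^sup>*)"

definition vertex_sum :: "'a ugraph \<Rightarrow> ('a set \<Rightarrow> nat) \<Rightarrow> 'a \<Rightarrow> nat" where
  "vertex_sum G f u = (\<Sum>e \<in> {e \<in> edges G. u \<in> e}. f e)"

definition local_antimagic_labeling :: "'a ugraph \<Rightarrow> ('a set \<Rightarrow> nat) \<Rightarrow> bool" where
  "local_antimagic_labeling G f \<longleftrightarrow>
     connected_graph G \<and>
     bij_betw f (edges G) {1..card (edges G)} \<and>
     (\<forall>u v. {u, v} \<in> edges G \<longrightarrow> vertex_sum G f u \<noteq> vertex_sum G f v)"

definition color_number :: "'a ugraph \<Rightarrow> ('a set \<Rightarrow> nat) \<Rightarrow> nat" where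
  "color_number G f = card (vertex_sum G f ` verts G)"

text \<open>
  The infimum is taken in \<^typ>\<open>enat\<close>: it is the attained minimum when a local antimagic
  labeling exists and \<open>\<infinity>\<close> otherwise, so a finite value entails that labelings exist.
\<close>

definition local_antimagic_chromatic_number :: "'a ugraph \<Rightarrow> enat" where
  "local_antimagic_chromatic_number G =
     (INF f \<in> {f. local_antimagic_labeling G f}. enat (color_number G f))"

text \<open>\<open>Spine i\<close> is the path vertex \<open>v\<^sub>i\<close>; \<open>Pendant i j\<close> is the \<open>j\<close>-th
  degree-one vertex attached to it.\<close>

datatype ct_vertex = Spine nat | Pendant nat nat

definition Ct3 :: "nat \<Rightarrow> nat \<Rightarrow> nat \<Rightarrow> ct_vertex ugraph" where
  "Ct3 n1 n2 n3 =
    ({Spine 1, Spine 2, Spine 3}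
       \<union> Pendant 1 ` {1..n1} \<union> Pendant 2 ` {1..n2} \<union> Pendant 3 ` {1..n3},
     {{Spine 1, Spine 2}, {Spine 2, Spine 3}}
       \<union> (\<lambda>j. {Spine 1, Pendant 1 j}) ` {1..n1}
       \<union> (\<lambda>j. {Spine 2, Pendant 2 j}) ` {1..n2}
       \<union> (\<lambda>j. {Spine 3, Pendant 3 j}) ` {1..n3})"

lemma connected_graph_Ct3: "connected_graph (Ct3 n1 n2 n3)"
proof -
  let ?G = "Ct3 n1 n2 n3"
  have sym: "sym ((adj_rel ?G)\<^sup>*)"
    by (intro sym_rtrancl) (auto simp: sym_def adj_rel_def insert_commute)
  have e12: "(Spine 1, Spine 2) \<in> adj_rel ?G" and e23: "(Spine 3, Spine 2) \<in> adj_rel ?G"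
    by (auto simp: adj_rel_def Ct3_def insert_commute)
  have p: "(Pendant i j, Spine i) \<in> adj_rel ?G" if "Pendant i j \<in> verts ?G" for i j
    using that by (auto simp: adj_rel_def Ct3_def insert_commute)
  have s: "(Spine i, Spine 2) \<in> (adj_rel ?G)\<^sup>*" if "i \<in> {1, 2, 3}" for i
    using that e12 e23 by auto
  have to2: "(u, Spine 2) \<in> (adj_rel ?G)\<^sup>*" if u: "u \<in> verts ?G" for u
  proof (cases u)
    case (Spine i)
    then have "i \<in> {1, 2, 3}" using u by (auto simp: Ct3_def)
    then show ?thesis using s Spine by simp
  next
    case (Pendant i j)
    then have "i \<in> {1, 2, 3}" using u by (auto simp: Ct3_def)
    then show ?thesis using s p u Pendant by (meson converse_rtrancl_into_rtrancl)
  qed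
  have "(u, v) \<in> (adj_rel ?G)\<^sup>*" if "u \<in> verts ?G" "v \<in> verts ?G" for u v
    using to2[OF that(1)] symD[OF sym to2[OF that(2)]] by (rule rtrancl_trans)
  moreover have "simple_graph ?G"
    by (auto simp: simple_graph_def Ct3_def)
  moreover have "verts ?G \<noteq> {}" by (simp add: Ct3_def)
  ultimately show ?thesis by (simp add: connected_graph_def)
qed

end

theory Submission
  imports Defs
begin

text \<open>
  The pendant vertices receive pairwise distinct colors, namely labels, all at most the number of
  edges. By \<open>C\<^sub>1\<close> the colors of the three spine vertices exceed every label; those of adjacent
  spine vertices differ by definition, and those of the two end spine vertices differ by \<open>C\<^sub>2\<close>,
  since the stars of the ends are disjoint. Hence every local antimagic labeling is injective on
  vertices, and it remains to find one. Let the edges at the middle vertex form one block and the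
  pendant edges at either end another, and give each end block smaller (respectively larger) labels
  than the middle block if it has at most (respectively at least) one edge more than the number of
  pendants at the middle. Then the sums at adjacent spine vertices, after cancelling the label of
  their common edge, are compared block by block.
\<close>

section \<open>Sums over finite sets and labelings ordered by a key\<close>

text \<open>Elements are added in increasing order: the new maximum \<open>b\<close> lies above all
  of \<open>A\<close>, a set of positive numbers, so it contributes at least
  \<open>card A + 1\<close>.\<close>

lemma sum_positive_ge_triangular:
  fixes S :: "nat set"
  assumes "finite S" and "0 \<notin> S"
  shows "card S * (card S + 1) div 2 \<le> \<Sum>S"
  using assms
proof (induction S rule: finite_linorder_max_induct)
  case empty
  then show ?case by simp
next
  case (insert b A)
  have "A \<subseteq> {1..<b}"
    using insert by (auto simp: Suc_le_eq intro: gr0I)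
  then have "card A \<le> b - 1"
    using card_mono[of "{1..<b}" A] by simp
  moreover have "b \<noteq> 0" using insert.prems by auto
  ultimately have "card A + 1 \<le> b" by simp
  moreover have "b \<notin> A" using insert.hyps by auto
  ultimately show ?case
    using insert by simp
qed

text \<open>The maximum of \<open>f\<close> on \<open>A\<close> separates the two sets of values.
  \<open>B\<close> inherits nonemptiness from \<open>A\<close> through the cardinalities, which
  makes the last inequality strict.\<close>

lemma sum_less_sum_of_card_le:
  fixes f :: "'a \<Rightarrow> nat"
  assumes "finite B" and "A \<noteq> {}" and "finite A" and "card A \<le> card B"
    and less: "\<And>a b. a \<in> A \<Longrightarrow> b \<in> B \<Longrightarrow> f a < f b"
  shows "sum f A < sum f B"
proof -
  let ?K = "Max (f ` A)"
  have "?K \<in> f ` A" using assms by (intro Max_in) auto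
  then have K: "?K < f b" if "b \<in> B" for b
    using less that by auto
  have "B \<noteq> {}" using assms by auto
  have "sum f A \<le> card A * ?K"
    using sum_bounded_above[of A f ?K] assms by simp
  also have "\<dots> \<le> (\<Sum>b\<in>B. ?K)" using assms by simp
  also have "\<dots> < sum f B"
    using K \<open>B \<noteq> {}\<close> \<open>finite B\<close> by (intro sum_strict_mono)
  finally show ?thesis .
qed

text \<open>Elements are labeled consecutively in order of nondecreasing key, ties being broken
  arbitrarily. This lets whole blocks of edges be placed below or above one another.\<close>

lemma ex_bij_betw_strict_mono_key:
  fixes r :: "'a \<Rightarrow> 'b::linorder"
  assumes "finite E"
  shows "\<exists>f. bij_betw f E {1..card E} \<and> (\<forall>x\<in>E. \<forall>y\<in>E. r x < r y \<longrightarrow> f x < f y)"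
  using assms
proof (induction E rule: finite_ranking_induct[where f = r])
  case empty
  then show ?case by (auto simp: bij_betw_def)
next
  case (insert x S)
  show ?case
  \<comment> \<open>The ranking induction only makes the key of \<open>x\<close> maximal; it does
    not exclude \<open>x \<in> S\<close>.\<close>
  proof (cases "x \<in> S")
    case True
    then show ?thesis using insert by (simp add: insert_absorb)
  next
    case False
    from insert obtain f where f: "bij_betw f S {1..card S}"
      and mono: "\<forall>x\<in>S. \<forall>y\<in>S. r x < r y \<longrightarrow> f x < f y" by auto
    let ?g = "f(x := Suc (card S))"
    have "bij_betw ?g S {1..card S}"
      using f False by (subst bij_betw_cong[of S _ f]) auto
    then have "bij_betw ?g (insert x S) (insert (Suc (card S)) {1..card S})"
      using notIn_Un_bij_betw[of x S ?g "{1..card S}"] False by simp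
    moreover have "insert (Suc (card S)) {1..card S} = {1..card (insert x S)}"
      using False insert.hyps by auto
    moreover have "f z < Suc (card S)" if "z \<in> S" for z
      using bij_betwE[OF f] that by (auto simp: less_Suc_eq_le)
    then have "\<forall>u\<in>insert x S. \<forall>v\<in>insert x S. r u < r v \<longrightarrow> ?g u < ?g v"
      using mono False insert.hyps by (auto simp: leD)
    ultimately show ?thesis by auto
  qed
qed

section \<open>Edges, stars and vertex sums of the caterpillar\<close>

definition pendant_edges :: "nat \<Rightarrow> nat \<Rightarrow> ct_vertex set set" where
  "pendant_edges i n = (\<lambda>j. {Spine i, Pendant i j}) ` {1..n}"

lemma finite_pendant_edges [simp]: "finite (pendant_edges i n)"
  by (simp add: pendant_edges_def)

lemma card_pendant_edges [simp]: "card (pendant_edges i n) = n"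
  by (auto simp: pendant_edges_def card_image inj_on_def doubleton_eq_iff)

lemma spine_edge_notin_pendant_edges [simp]: "{Spine i, Spine j} \<notin> pendant_edges k n"
  by (auto simp: pendant_edges_def doubleton_eq_iff)

lemma pendant_edges_disjoint: "i \<noteq> k \<Longrightarrow> pendant_edges i m \<inter> pendant_edges k n = {}"
  by (auto simp: pendant_edges_def doubleton_eq_iff)

lemma edges_Ct3:
  "edges (Ct3 n1 n2 n3) = {{Spine 1, Spine 2}, {Spine 2, Spine 3}}
     \<union> pendant_edges 1 n1 \<union> pendant_edges 2 n2 \<union> pendant_edges 3 n3"
  by (simp add: Ct3_def pendant_edges_def)

lemma finite_edges_Ct3 [simp]: "finite (edges (Ct3 n1 n2 n3))"
  by (simp add: edges_Ct3)

lemma card_edges_Ct3 [simp]: "card (edges (Ct3 n1 n2 n3)) = n1 + n2 + n3 + 2"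
  by (simp add: edges_Ct3 card_Un_disjoint Int_Un_distrib2 pendant_edges_disjoint doubleton_eq_iff)

lemma card_verts_Ct3: "card (verts (Ct3 n1 n2 n3)) = n1 + n2 + n3 + 3"
proof -
  have "card (Pendant i ` {m..n}) = n + 1 - m" for i m n
    by (simp add: card_image inj_on_def)
  moreover have "Pendant i ` A \<inter> Pendant k ` B = {}" if "i \<noteq> k" for i k A B
    using that by auto
  moreover have "Spine i \<notin> Pendant k ` A" for i k A
    by auto
  ultimately show ?thesis
    by (simp add: Ct3_def card_Un_disjoint Int_Un_distrib2)
qed

lemma incident_Spine1: "{e \<in> edges (Ct3 n1 n2 n3). Spine 1 \<in> e}
    = insert {Spine 1, Spine 2} (pendant_edges 1 n1)"
  by (auto simp: edges_Ct3 pendant_edges_def)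

lemma incident_Spine2: "{e \<in> edges (Ct3 n1 n2 n3). Spine 2 \<in> e}
    = insert {Spine 1, Spine 2} (insert {Spine 2, Spine 3} (pendant_edges 2 n2))"
  by (auto simp: edges_Ct3 pendant_edges_def)

lemma incident_Spine3: "{e \<in> edges (Ct3 n1 n2 n3). Spine 3 \<in> e}
    = insert {Spine 2, Spine 3} (pendant_edges 3 n3)"
  by (auto simp: edges_Ct3 pendant_edges_def)

lemma pendant_edge_in_edges:
  "Pendant i j \<in> verts (Ct3 n1 n2 n3) \<Longrightarrow> {Spine i, Pendant i j} \<in> edges (Ct3 n1 n2 n3)"
  by (auto simp: Ct3_def)

lemma vertex_sum_Pendant:
  assumes "Pendant i j \<in> verts (Ct3 n1 n2 n3)"
  shows "vertex_sum (Ct3 n1 n2 n3) f (Pendant i j) = f {Spine i, Pendant i j}"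
proof -
  have "{e \<in> edges (Ct3 n1 n2 n3). Pendant i j \<in> e} = {{Spine i, Pendant i j}}"
    using assms by (auto simp: Ct3_def)
  then show ?thesis by (simp add: vertex_sum_def)
qed

lemma vertex_sum_Spine1: "vertex_sum (Ct3 n1 n2 n3) f (Spine 1)
    = f {Spine 1, Spine 2} + sum f (pendant_edges 1 n1)"
  by (simp add: vertex_sum_def incident_Spine1[simplified])

lemma vertex_sum_Spine2: "vertex_sum (Ct3 n1 n2 n3) f (Spine 2)
    = f {Spine 1, Spine 2} + f {Spine 2, Spine 3} + sum f (pendant_edges 2 n2)"
  by (simp add: vertex_sum_def incident_Spine2 doubleton_eq_iff)

lemma vertex_sum_Spine3: "vertex_sum (Ct3 n1 n2 n3) f (Spine 3)
    = f {Spine 2, Spine 3} + sum f (pendant_edges 3 n3)"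
  by (simp add: vertex_sum_def incident_Spine3)

lemma edge_Ct3_cases:
  assumes "{u, v} \<in> edges (Ct3 n1 n2 n3)"
  obtains "{u, v} = {Spine 1, Spine 2}" | "{u, v} = {Spine 2, Spine 3}"
  | i j where "{u, v} = {Spine i, Pendant i j}" and "i \<in> {1, 2, 3}"
      and "Pendant i j \<in> verts (Ct3 n1 n2 n3)"
proof -
  have pendant: "{u, v} \<in> pendant_edges i n \<Longrightarrow> \<exists>j\<in>{1..n}. {u, v} = {Spine i, Pendant i j}" for i n
    by (auto simp: pendant_edges_def)
  have "Pendant 1 j \<in> verts (Ct3 n1 n2 n3)" if "j \<in> {1..n1}" for j
    using that by (simp add: Ct3_def)
  moreover have "Pendant 2 j \<in> verts (Ct3 n1 n2 n3)" if "j \<in> {1..n2}" for j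
    using that by (simp add: Ct3_def)
  moreover have "Pendant 3 j \<in> verts (Ct3 n1 n2 n3)" if "j \<in> {1..n3}" for j
    using that by (simp add: Ct3_def)
  ultimately show thesis
    using assms that pendant unfolding edges_Ct3 Un_iff insert_iff empty_iff by metis
qed

section \<open>Arbitrary bijective labelings under \<open>C1\<close>\<close>

context
  fixes n1 n2 n3 :: nat and f :: "ct_vertex set \<Rightarrow> nat"
  assumes bij: "bij_betw f (edges (Ct3 n1 n2 n3)) {1..n1 + n2 + n3 + 2}"
    and C1: "n1 + n2 + n3 + 2 < (n1 + 1) * (n1 + 2) div 2"
      "n1 + n2 + n3 + 2 < (n2 + 2) * (n2 + 3) div 2"
      "n1 + n2 + n3 + 2 < (n3 + 1) * (n3 + 2) div 2"
begin

lemma label_range: "e \<in> edges (Ct3 n1 n2 n3) \<Longrightarrow> f e \<in> {1..n1 + n2 + n3 + 2}"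
  using bij bij_betwE by blast

lemma inj_on_incident: "inj_on f {e \<in> edges (Ct3 n1 n2 n3). u \<in> e}"
  using bij by (rule inj_on_subset[OF bij_betw_imp_inj_on]) auto

lemma vertex_sum_eq_sum_image:
  "vertex_sum (Ct3 n1 n2 n3) f u = \<Sum>(f ` {e \<in> edges (Ct3 n1 n2 n3). u \<in> e})"
  using sum.reindex[OF inj_on_incident, of id u] by (simp add: vertex_sum_def)

text \<open>The labels at a vertex of degree \<open>d\<close> are \<open>d\<close> distinct positive
  integers.\<close>

lemma vertex_sum_ge_triangular:
  fixes u :: ct_vertex
  defines "d \<equiv> card {e \<in> edges (Ct3 n1 n2 n3). u \<in> e}"
  shows "d * (d + 1) div 2 \<le> vertex_sum (Ct3 n1 n2 n3) f u"
proof -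
  let ?S = "f ` {e \<in> edges (Ct3 n1 n2 n3). u \<in> e}"
  have "card ?S = d"
    unfolding d_def using inj_on_incident by (rule card_image)
  moreover have "0 \<notin> ?S" using label_range by fastforce
  ultimately show ?thesis
    using sum_positive_ge_triangular[of ?S] by (simp add: vertex_sum_eq_sum_image)
qed

text \<open>The spine vertices have degrees \<open>n1 + 1\<close>, \<open>n2 + 2\<close> and
  \<open>n3 + 1\<close>, so their triangular bounds are exactly the three numbers in
  \<open>C1\<close>.\<close>

lemma vertex_sum_Spine_gt:
  assumes "i \<in> {1, 2, 3}"
  shows "n1 + n2 + n3 + 2 < vertex_sum (Ct3 n1 n2 n3) f (Spine i)"
proof -
  have card2: "card (insert {Spine 1, Spine 2} (insert {Spine 2, Spine 3} (pendant_edges 2 n2))) = n2 + 2"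
    by (simp add: doubleton_eq_iff)
  have "n1 + n2 + n3 + 2 < vertex_sum (Ct3 n1 n2 n3) f (Spine 1)"
    using vertex_sum_ge_triangular[of "Spine 1"] C1(1)
    unfolding incident_Spine1 by simp
  moreover have "n1 + n2 + n3 + 2 < vertex_sum (Ct3 n1 n2 n3) f (Spine 2)"
    using vertex_sum_ge_triangular[of "Spine 2"] C1(2)
    unfolding incident_Spine2 card2 by (simp add: numeral_eq_Suc)
  moreover have "n1 + n2 + n3 + 2 < vertex_sum (Ct3 n1 n2 n3) f (Spine 3)"
    using vertex_sum_ge_triangular[of "Spine 3"] C1(3)
    unfolding incident_Spine3 by simp
  ultimately show ?thesis using assms by auto
qed

lemma vertex_sum_Pendant_le:
  assumes "Pendant i j \<in> verts (Ct3 n1 n2 n3)"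
  shows "vertex_sum (Ct3 n1 n2 n3) f (Pendant i j) \<le> n1 + n2 + n3 + 2"
  using label_range[OF pendant_edge_in_edges[OF assms]] vertex_sum_Pendant[OF assms] by simp

text \<open>Along a pendant edge the two sums lie on different sides of the number of edges, so only
  the two spine edges have to be checked.\<close>

lemma local_antimagic_labelingI:
  assumes "vertex_sum (Ct3 n1 n2 n3) f (Spine 1) \<noteq> vertex_sum (Ct3 n1 n2 n3) f (Spine 2)"
    and "vertex_sum (Ct3 n1 n2 n3) f (Spine 2) \<noteq> vertex_sum (Ct3 n1 n2 n3) f (Spine 3)"
  shows "local_antimagic_labeling (Ct3 n1 n2 n3) f"
  unfolding local_antimagic_labeling_def
proof (intro conjI allI impI)
  show "connected_graph (Ct3 n1 n2 n3)" by (rule connected_graph_Ct3)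
  show "bij_betw f (edges (Ct3 n1 n2 n3)) {1..card (edges (Ct3 n1 n2 n3))}"
    using bij by simp
  fix u v assume "{u, v} \<in> edges (Ct3 n1 n2 n3)"
  then show "vertex_sum (Ct3 n1 n2 n3) f u \<noteq> vertex_sum (Ct3 n1 n2 n3) f v"
  proof (cases rule: edge_Ct3_cases)
    case (3 i j)
    then show ?thesis
      using vertex_sum_Spine_gt[of i] vertex_sum_Pendant_le[of i j]
      by (auto simp: doubleton_eq_iff)
  qed (use assms in \<open>auto simp: doubleton_eq_iff\<close>)
qed

text \<open>Equal sums would make the label sets of the two end stars a pair \<open>S1\<close>,
  \<open>S3\<close> forbidden by \<open>C2\<close>; the stars share no edge, so injectivity keeps
  their labels disjoint.\<close>

lemma end_sums_differ:
  assumes C2: "\<not> (\<exists>S1 S3. S1 \<subseteq> {1..n1 + n2 + n3 + 2} \<and> S3 \<subseteq> {1..n1 + n2 + n3 + 2} \<and>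
               S1 \<inter> S3 = {} \<and> card S1 = n1 + 1 \<and> card S3 = n3 + 1 \<and> \<Sum>S1 = \<Sum>S3)"
  shows "vertex_sum (Ct3 n1 n2 n3) f (Spine 1) \<noteq> vertex_sum (Ct3 n1 n2 n3) f (Spine 3)"
proof
  assume eq: "vertex_sum (Ct3 n1 n2 n3) f (Spine 1) = vertex_sum (Ct3 n1 n2 n3) f (Spine 3)"
  let ?I = "\<lambda>i::nat. {e \<in> edges (Ct3 n1 n2 n3). Spine i \<in> e}"
  have "?I 1 \<inter> ?I 3 = {}"
    unfolding incident_Spine1 incident_Spine3
    by (simp add: doubleton_eq_iff pendant_edges_disjoint)
  then have "f ` ?I 1 \<inter> f ` ?I 3 = {}"
    using inj_on_image_Int[OF bij_betw_imp_inj_on[OF bij], of "?I 1" "?I 3"]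
    by (simp only: Collect_subset image_empty)
  moreover have "f ` ?I i \<subseteq> {1..n1 + n2 + n3 + 2}" for i
    using label_range by (intro image_subsetI) simp
  moreover have "card (f ` ?I 1) = n1 + 1"
    by (subst card_image[OF inj_on_incident], subst incident_Spine1) simp
  moreover have "card (f ` ?I 3) = n3 + 1"
    by (subst card_image[OF inj_on_incident], subst incident_Spine3) simp
  moreover have "\<Sum>(f ` ?I 1) = \<Sum>(f ` ?I 3)"
    using eq by (simp only: vertex_sum_eq_sum_image)
  ultimately show False using C2 by meson
qed

lemma inj_on_vertex_sum:
  assumes lal: "local_antimagic_labeling (Ct3 n1 n2 n3) f"
    and ends: "vertex_sum (Ct3 n1 n2 n3) f (Spine 1) \<noteq> vertex_sum (Ct3 n1 n2 n3) f (Spine 3)"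
  shows "inj_on (vertex_sum (Ct3 n1 n2 n3) f) (verts (Ct3 n1 n2 n3))"
proof (rule inj_onI)
  fix u v assume u: "u \<in> verts (Ct3 n1 n2 n3)" and v: "v \<in> verts (Ct3 n1 n2 n3)"
    and eq: "vertex_sum (Ct3 n1 n2 n3) f u = vertex_sum (Ct3 n1 n2 n3) f v"
  have spine: "i \<in> {1, 2, 3}" if "Spine i \<in> verts (Ct3 n1 n2 n3)" for i
    using that by (auto simp: Ct3_def)
  have mixed: "vertex_sum (Ct3 n1 n2 n3) f (Pendant i j) \<noteq> vertex_sum (Ct3 n1 n2 n3) f (Spine k)"
    if "Pendant i j \<in> verts (Ct3 n1 n2 n3)" and "Spine k \<in> verts (Ct3 n1 n2 n3)" for i j k
    using vertex_sum_Pendant_le[OF that(1)] vertex_sum_Spine_gt[OF spine[OF that(2)]] by simp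
  show "u = v"
  proof (cases u; cases v)
    fix i j assume uv: "u = Spine i" "v = Spine j"
    have "{Spine 1, Spine 2} \<in> edges (Ct3 n1 n2 n3)" "{Spine 2, Spine 3} \<in> edges (Ct3 n1 n2 n3)"
      by (simp_all add: edges_Ct3)
    then have "vertex_sum (Ct3 n1 n2 n3) f (Spine 1) \<noteq> vertex_sum (Ct3 n1 n2 n3) f (Spine 2)"
      "vertex_sum (Ct3 n1 n2 n3) f (Spine 2) \<noteq> vertex_sum (Ct3 n1 n2 n3) f (Spine 3)"
      using lal by (simp_all add: local_antimagic_labeling_def)
    then show ?thesis using uv eq ends spine[of i] spine[of j] u v by auto
  next
    fix i j k l assume uv: "u = Pendant i j" "v = Pendant k l"
    then have "f {Spine i, Pendant i j} = f {Spine k, Pendant k l}"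
      using eq u v vertex_sum_Pendant by simp
    then have "{Spine i, Pendant i j} = {Spine k, Pendant k l}"
      using inj_onD[OF bij_betw_imp_inj_on[OF bij]] u v uv pendant_edge_in_edges by blast
    then show ?thesis using uv by (auto simp: doubleton_eq_iff)
  \<comment> \<open>What remains are the two cases with one spine and one pendant vertex.\<close>
  qed (use mixed eq u v in \<open>metis\<close>)+
qed

end

section \<open>Construction of a labeling and the chromatic number\<close>

theorem theorem3p3:
  fixes n1 n2 n3 :: nat
  assumes "n1 \<ge> 1" and "n2 \<ge> 1" and "n3 \<ge> 1"
    and C1: "Min {(n1 + 1) * (n1 + 2) div 2, (n2 + 2) * (n2 + 3) div 2, (n3 + 1) * (n3 + 2) div 2}
               > n1 + n2 + n3 + 2"
    and C2: "\<not> (\<exists>S1 S3. S1 \<subseteq> {1..n1 + n2 + n3 + 2} \<and> S3 \<subseteq> {1..n1 + n2 + n3 + 2} \<and>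
               S1 \<inter> S3 = {} \<and> card S1 = n1 + 1 \<and> card S3 = n3 + 1 \<and> \<Sum>S1 = \<Sum>S3)"
  shows "local_antimagic_chromatic_number (Ct3 n1 n2 n3) = enat (n1 + n2 + n3 + 3)"
proof -
  let ?G = "Ct3 n1 n2 n3" and ?a = "{Spine 1, Spine 2}" and ?b = "{Spine 2, Spine 3}"
  let ?P1 = "pendant_edges 1 n1" and ?P2 = "pendant_edges 2 n2" and ?P3 = "pendant_edges 3 n3"
  have C1': "n1 + n2 + n3 + 2 < (n1 + 1) * (n1 + 2) div 2"
    "n1 + n2 + n3 + 2 < (n2 + 2) * (n2 + 3) div 2"
    "n1 + n2 + n3 + 2 < (n3 + 1) * (n3 + 2) div 2"
    using C1 by (simp_all del: mult_Suc mult_Suc_right)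
  \<comment> \<open>The infimum thus runs over a constant, and only the existence of a labeling is
    left to show.\<close>
  have colors: "color_number ?G f = n1 + n2 + n3 + 3" if "local_antimagic_labeling ?G f" for f
  proof -
    have "bij_betw f (edges ?G) {1..n1 + n2 + n3 + 2}"
      using that by (simp add: local_antimagic_labeling_def)
    then show ?thesis
      using card_image[OF inj_on_vertex_sum[OF _ C1' that]] end_sums_differ[OF _ C1' C2]
      by (simp add: color_number_def card_verts_Ct3)
  qed
  \<comment> \<open>Key 1 marks the star of the middle vertex. The threshold \<open>n2 + 1\<close>
    is the size of that star without the one edge shared with an end.\<close>
  define r :: "ct_vertex set \<Rightarrow> nat" where
    "r e = (if e \<in> ?P1 then if n1 \<le> n2 + 1 then 0 else 2
            else if e \<in> ?P3 then if n3 \<le> n2 + 1 then 0 else 2 else 1)" for e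
  obtain f where bij: "bij_betw f (edges ?G) {1..n1 + n2 + n3 + 2}"
    and mono: "\<And>x y. x \<in> edges ?G \<Longrightarrow> y \<in> edges ?G \<Longrightarrow> r x < r y \<Longrightarrow> f x < f y"
    using ex_bij_betw_strict_mono_key[of "edges ?G" r] by auto
  have P_ne: "pendant_edges i n \<noteq> {}" if "n \<ge> 1" for i n
    using that card_pendant_edges[of i n] by fastforce
  \<comment> \<open>Either \<open>P\<close> has smaller labels and no more terms than
    \<open>M\<close>, or larger labels and more terms, so the comparison is strict in both
    cases.\<close>
  have blocks: "sum f P \<noteq> sum f M"
    if P: "P \<subseteq> edges ?G" "P \<noteq> {}" and M: "M \<subseteq> edges ?G" "card M = n2 + 1"
      and rM: "\<And>e. e \<in> M \<Longrightarrow> r e = 1"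
      and rP: "\<And>e. e \<in> P \<Longrightarrow> r e = (if card P \<le> n2 + 1 then 0 else 2)" for P M
  proof -
    have fin: "finite P" "finite M"
      using P M finite_subset finite_edges_Ct3 by blast+
    show ?thesis
    proof (cases "card P \<le> n2 + 1")
      case True
      then have "sum f P < sum f M"
        using P M rM rP fin by (intro sum_less_sum_of_card_le mono) auto
      then show ?thesis by simp
    next
      case False
      moreover have "M \<noteq> {}" using M by auto
      ultimately have "sum f M < sum f P"
        using P M rM rP fin by (intro sum_less_sum_of_card_le mono) auto
      then show ?thesis by simp
    qed
  qed
  have disj: "e \<notin> pendant_edges k m" if "e \<in> pendant_edges i n" "i \<noteq> k" for e i k m n
    using that pendant_edges_disjoint by blast
  \<comment> \<open>These are the sums at \<open>Spine 1\<close> and \<open>Spine 2\<close> with the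
    common term \<open>f ?a\<close> cancelled; for \<open>Spine 3\<close> the cancelled term is
    \<open>f ?b\<close>.\<close>
  have "sum f ?P1 \<noteq> sum f (insert ?b ?P2)"
    using assms(1) by (intro blocks) (auto simp: edges_Ct3 r_def P_ne disj)
  moreover have "sum f ?P3 \<noteq> sum f (insert ?a ?P2)"
    using assms(3) by (intro blocks) (auto simp: edges_Ct3 r_def P_ne disj)
  ultimately have "local_antimagic_labeling ?G f"
    by (intro local_antimagic_labelingI[OF bij C1'])
      (simp_all only: vertex_sum_Spine1 vertex_sum_Spine2 vertex_sum_Spine3, simp_all)
  \<comment> \<open>Over an empty set the infimum would be \<infinity>.\<close>
  then have "{f. local_antimagic_labeling ?G f} \<noteq> {}" by blast
  then show ?thesis
    using colors by (simp add: local_antimagic_chromatic_number_def)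
qed

end
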